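(* For any differentiable function $F:GL(k)\to\mathbb{R}$ and any $W\in GL(k)$ the relative gradient satisfies $$\nabla^{\mathrm{rel}}F(W)=\bigl(\nabla F(W)\bigr)W^{\mathsf T},$$ so that a relative gradient ascent step $W\leftarrow\bigl(I_k+\alpha\nabla^{\mathrm{rel}}F(W)\bigr)W$ is exactly $W\leftarrow W+\alpha\,\bigl(\nabla F(W)\bigr)W^{\mathsf T}W$. For the ICA log-likelihood $$\mathcal{L}(W)=\log|\det W|+\sum_{j=1}^k\mathbb{E}\bigl[\log p_j(w_j^{\mathsf T}X)\bigr],$$ where $w_1^{\mathsf T},\dots,w_k^{\mathsf T}$ are the rows of $W$, one has $$\nabla^{\mathrm{rel}}\mathcal{L}(W)=I_k+\mathbb{E}\bigl[\eta(C)C^{\mathsf T}\bigr],\qquad C=WX,$$ and the update rule $W\leftarrow W+\alpha\,(\nabla_W\mathcal{L})\,W^{\mathsf T}W$ reads $$W\leftarrow\Bigl(I_k+\alpha\bigl(I_k+\mathbb{E}[\eta(C)C^{\mathsf T}]\bigr)\Bigr)W .$$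
   Context: $GL(k)$ is the group of invertible real $k\times k$ matrices, $I_k$ the identity matrix; $\nabla F(W)$ is the matrix of partial derivatives $\partial F/\partial W_{ij}$. The relative gradient of a differentiable $F$ at $W$ is the matrix $\nabla^{\mathrm{rel}}F(W)$ determined by $$F\bigl((I_k+\varepsilon)W\bigr)=F(W)+\langle\nabla^{\mathrm{rel}}F(W),\varepsilon\rangle+o(\|\varepsilon\|),\qquad \varepsilon\in\mathbb{R}^{k\times k},$$ with $\langle M,N\rangle=\operatorname{tr}(M^{\mathsf T}N)$. Setting for the log-likelihood: $X=AZ$ with $A\in\mathbb{R}^{k\times k}$ invertible and $Z$ a random vector in $\mathbb{R}^k$ whose components are mutually independent, non-constant, centred, with strictly positive Lebesgue densities, at most one of them Gaussian, and with scale fixed by $\operatorname{Var}(Z_j)=1$ or by $\mathbb{E}[\eta_j(Z_j)Z_j]=-1$. The model densities $p_1,\dots,p_k$ on $\mathbb{R}$ are fixed, differentiable and strictly positive (they need not be the true densities of the $Z_j$), $\eta_j:=(\log p_j)'=p_j'/p_j$, and $\eta(c):=[\eta_1(c_1),\dots,\eta_k(c_k)]^{\mathsf T}$. Integrability conditions are assumed that permit differentiation under the expectation: the expectations above are finite, $\mathcal{L}$ is differentiable at $W$, and the derivatives of $\mathbb{E}[\log p_j(w_j^{\mathsf T}X)]$ with respect to the entries of $W$ may be computed inside the expectation. $\alpha>0$ is a step size. *)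

theory Defs
  imports "HOL-Probability.Probability" "HOL-Library.Landau_Symbols"
begin

definition GL :: "(real^'k^'k) set" where
  "GL = {W. invertible W}"

definition frob_inner :: "real^'k^'k \<Rightarrow> real^'k^'k \<Rightarrow> real" where
  "frob_inner M N = trace (transpose M ** N)"

(* axis i (axis j 1) is the matrix unit whose only nonzero entry is a 1 in row i, column j. *)
definition partial_deriv :: "(real^'k^'k \<Rightarrow> real) \<Rightarrow> 'k \<Rightarrow> 'k \<Rightarrow> real^'k^'k \<Rightarrow> real" where
  "partial_deriv F i j W = deriv (\<lambda>t. F (W + t *\<^sub>R axis i (axis j 1))) 0"

definition grad :: "(real^'k^'k \<Rightarrow> real) \<Rightarrow> real^'k^'k \<Rightarrow> real^'k^'k" where
  "grad F W = (\<chi> i j. partial_deriv F i j W)"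

(* The library norm on real^'k^'k is the Frobenius norm.  Functions on GL are represented by
   total functions; as GL is open, their values elsewhere do not matter when W is in GL. *)
definition has_relative_gradient ::
    "(real^'k^'k \<Rightarrow> real) \<Rightarrow> real^'k^'k \<Rightarrow> real^'k^'k \<Rightarrow> bool" where
  "has_relative_gradient F G W \<longleftrightarrow>
     (\<lambda>\<epsilon>. F ((mat 1 + \<epsilon>) ** W) - F W - frob_inner G \<epsilon>) \<in> o[at 0](\<lambda>\<epsilon>. norm \<epsilon>)"

definition relative_gradient :: "(real^'k^'k \<Rightarrow> real) \<Rightarrow> real^'k^'k \<Rightarrow> real^'k^'k" where
  "relative_gradient F W = (THE G. has_relative_gradient F G W)"

definition relative_ascent_step ::
    "real \<Rightarrow> (real^'k^'k \<Rightarrow> real) \<Rightarrow> real^'k^'k \<Rightarrow> real^'k^'k" where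
  "relative_ascent_step \<alpha> F W = (mat 1 + \<alpha> *\<^sub>R relative_gradient F W) ** W"

definition outer_prod :: "real^'k \<Rightarrow> real^'k \<Rightarrow> real^'k^'k" where
  "outer_prod u v = (\<chi> i j. u $ i * v $ j)"

definition score :: "(real \<Rightarrow> real) \<Rightarrow> real \<Rightarrow> real" where
  "score q x = deriv (\<lambda>t. ln (q t)) x"

definition score_vec :: "('k \<Rightarrow> real \<Rightarrow> real) \<Rightarrow> real^'k \<Rightarrow> real^'k" where
  "score_vec p c = (\<chi> j. score (p j) (c $ j))"

definition gaussian_rv :: "'a measure \<Rightarrow> ('a \<Rightarrow> real) \<Rightarrow> bool" where
  "gaussian_rv M Y \<longleftrightarrow>
     (\<exists>\<mu> \<sigma>. \<sigma> > 0 \<and> distributed M lborel Y (\<lambda>x. ennreal (normal_density \<mu> \<sigma> x)))"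

(* In "scale", a Bochner integral equal to 1 or -1 is nonzero, so its integrand is integrable.
   The normalisation may be chosen separately for each component, which includes a common choice. *)
locale ica_model = prob_space M
  for M :: "'a measure" +
  fixes A :: "real^'k^'k"
    and Z X :: "'a \<Rightarrow> real^'k"
    and p :: "'k \<Rightarrow> real \<Rightarrow> real"
  assumes mixing_invertible: "invertible A"
    and mixing: "\<And>\<omega>. \<omega> \<in> space M \<Longrightarrow> X \<omega> = A *v Z \<omega>"
    and source_rv: "random_variable borel Z"
    and independent: "indep_vars (\<lambda>_. borel) (\<lambda>j \<omega>. Z \<omega> $ j) UNIV"
    and nonconstant: "\<And>j. \<not> (\<exists>c. AE \<omega> in M. Z \<omega> $ j = c)"
    and source_integrable: "\<And>j. integrable M (\<lambda>\<omega>. Z \<omega> $ j)"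
    and centred: "\<And>j. expectation (\<lambda>\<omega>. Z \<omega> $ j) = 0"
    and source_density: "\<And>j. \<exists>q. (\<forall>x. q x > (0::real)) \<and>
           distributed M lborel (\<lambda>\<omega>. Z \<omega> $ j) (\<lambda>x. ennreal (q x))"
    and at_most_one_gaussian: "\<And>i j. gaussian_rv M (\<lambda>\<omega>. Z \<omega> $ i) \<Longrightarrow>
           gaussian_rv M (\<lambda>\<omega>. Z \<omega> $ j) \<Longrightarrow> i = j"
    and scale: "\<And>j. variance (\<lambda>\<omega>. Z \<omega> $ j) = 1 \<or>
           expectation (\<lambda>\<omega>. score (p j) (Z \<omega> $ j) * Z \<omega> $ j) = -1"
    and model_pos: "\<And>j x. p j x > 0"
    and model_differentiable: "\<And>j x. p j differentiable (at x)"
    and model_density: "\<And>j. has_bochner_integral lborel (p j) 1"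

definition expected_log_density ::
    "'a measure \<Rightarrow> ('a \<Rightarrow> real^'k) \<Rightarrow> ('k \<Rightarrow> real \<Rightarrow> real) \<Rightarrow> 'k \<Rightarrow> real^'k^'k \<Rightarrow> real" where
  "expected_log_density M X p j W = (\<integral>\<omega>. ln (p j (row j W \<bullet> X \<omega>)) \<partial>M)"

definition log_likelihood ::
    "'a measure \<Rightarrow> ('a \<Rightarrow> real^'k) \<Rightarrow> ('k \<Rightarrow> real \<Rightarrow> real) \<Rightarrow> real^'k^'k \<Rightarrow> real" where
  "log_likelihood M X p W = ln \<bar>det W\<bar> + (\<Sum>j\<in>UNIV. expected_log_density M X p j W)"

definition score_moment ::
    "'a measure \<Rightarrow> ('a \<Rightarrow> real^'k) \<Rightarrow> ('k \<Rightarrow> real \<Rightarrow> real) \<Rightarrow> real^'k^'k \<Rightarrow> real^'k^'k" where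
  "score_moment M X p W = (\<integral>\<omega>. outer_prod (score_vec p (W *v X \<omega>)) (W *v X \<omega>) \<partial>M)"

(* Finiteness of the log-likelihood is required near W, so that its derivatives at W are not
   affected by the value 0 of the Bochner integral on non-integrable functions.  The last clause
   is the interchange of derivative and expectation, with the derivative inside left unevaluated. *)
definition ica_regular_at ::
    "'a measure \<Rightarrow> ('a \<Rightarrow> real^'k) \<Rightarrow> ('k \<Rightarrow> real \<Rightarrow> real) \<Rightarrow> real^'k^'k \<Rightarrow> bool" where
  "ica_regular_at M X p W \<longleftrightarrow>
     (\<forall>\<^sub>F V in nhds W. \<forall>j. integrable M (\<lambda>\<omega>. ln (p j (row j V \<bullet> X \<omega>)))) \<and>
     integrable M (\<lambda>\<omega>. outer_prod (score_vec p (W *v X \<omega>)) (W *v X \<omega>)) \<and>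
     log_likelihood M X p differentiable (at W) \<and>
     (\<forall>j a b.
        ((\<lambda>t. expected_log_density M X p j (W + t *\<^sub>R axis a (axis b 1))) has_real_derivative
           (\<integral>\<omega>. partial_deriv (\<lambda>V. ln (p j (row j V \<bullet> X \<omega>))) a b W \<partial>M)) (at 0))"

end

theory Submission
  imports Defs
begin

text \<open>
  The map \<open>E \<mapsto> (I + E) W\<close> is affine with linear part \<open>E \<mapsto> E W\<close>, so by the chain rule the
  derivative of \<open>E \<mapsto> F ((I + E) W)\<close> at \<open>0\<close> is \<open>E \<mapsto> \<langle>grad F W, E W\<rangle>\<close>.  The adjoint of right
  multiplication by \<open>W\<close> in the trace inner product is right multiplication by its transpose
  (\<open>frob_inner_mult_right\<close>), and so the relative gradient is \<open>grad F W\<close> times \<open>W\<^sup>T\<close>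
  (\<open>has_relative_gradient_grad\<close>).  It is unique because a derivative is unique.  The form of the
  ascent step is then a matter of expanding the product.

  For the log-likelihood it remains to compute the partial derivatives.  Put \<open>B = W\<^sup>-\<^sup>1\<close>
  and \<open>C = W X\<close>.
  Moving the entry \<open>(a, b)\<close> of \<open>W\<close> by \<open>t\<close> multiplies \<open>det W\<close> by the affine factor
  \<open>1 + t B\<^sub>b\<^sub>a\<close>, which is an instance of Cramer's rule (\<open>det_add_matrix_unit\<close>); hence the
  gradient of \<open>log |det W|\<close> is \<open>B\<^sup>T\<close>.  The same move changes only the row
  \<open>w\<^sub>a\<close>, so of the expected log-densities only the one with index \<open>a\<close> contributes, and its
  derivative is \<open>E[\<eta>\<^sub>a(C\<^sub>a) X\<^sub>b]\<close>.  Since \<open>X = B C\<close>, this is the entry \<open>(a, b)\<close> of \<open>S B\<^sup>T\<close>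
  with \<open>S = E[\<eta>(C) C\<^sup>T]\<close>.  Altogether the gradient is \<open>(I + S) B\<^sup>T\<close> (\<open>grad_log_likelihood\<close>),
  and multiplication by \<open>W\<^sup>T\<close> cancels \<open>B\<^sup>T\<close>.
\<close>

section \<open>The trace inner product and right multiplication\<close>

lemma frob_inner_eq_inner: "frob_inner M N = M \<bullet> N"
proof -
  have "frob_inner M N = (\<Sum>i\<in>UNIV. \<Sum>j\<in>UNIV. M $ j $ i * N $ j $ i)"
    by (simp add: frob_inner_def trace_def matrix_matrix_mult_def transpose_def)
  also have "\<dots> = (\<Sum>j\<in>UNIV. \<Sum>i\<in>UNIV. M $ j $ i * N $ j $ i)"
    by (rule sum.swap)
  finally show ?thesis by (simp add: inner_vec_def)
qed

text \<open>Cyclicity of the trace moves \<open>W\<close> to the other factor.\<close>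

lemma frob_inner_mult_right:
  "frob_inner G (E ** W) = frob_inner (G ** transpose W) E"
proof -
  have "frob_inner G (E ** W) = trace ((transpose G ** E) ** W)"
    by (simp add: frob_inner_def matrix_mul_assoc)
  also have "\<dots> = trace (W ** (transpose G ** E))"
    by (rule trace_mul_sym)
  finally show ?thesis
    by (simp add: frob_inner_def matrix_mul_assoc matrix_transpose_mul)
qed

lemma matrix_add_rdistrib:
  fixes A B :: "'a::semiring_1^'n^'m"
  shows "(A + B) ** C = A ** C + B ** C"
  by (simp add: vec_eq_iff matrix_matrix_mult_def distrib_right sum.distrib)

lemma bounded_linear_matrix_mult_left:
  "bounded_linear (\<lambda>E :: real^'n^'m. E ** (W :: real^'k^'n))"
  by (intro linear_conv_bounded_linear[THEN iffD1] linearI)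
     (simp_all add: matrix_add_rdistrib scalar_matrix_assoc)

section \<open>Relative and ordinary gradients\<close>

lemma open_GL: "open (GL :: (real^'k^'k) set)"
proof -
  have "continuous_on UNIV (\<lambda>W :: real^'k^'k. det W)"
    unfolding det_def by (intro continuous_intros)
  hence "open ((\<lambda>W :: real^'k^'k. det W) -` (- {0}))"
    by (intro open_vimage) auto
  moreover have "GL = (\<lambda>W :: real^'k^'k. det W) -` (- {0})"
    by (auto simp: GL_def invertible_det_nz)
  ultimately show ?thesis by simp
qed

text \<open>
  The defining expansion, with its error \<open>o(\<parallel>E\<parallel>)\<close>, is Frechet differentiability in \<open>E\<close>.  This
  gives access to the chain rule and to the uniqueness of derivatives.
\<close>

lemma has_relative_gradient_iff_has_derivative:
  "has_relative_gradient F G W \<longleftrightarrow>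
     ((\<lambda>E. F ((mat 1 + E) ** W)) has_derivative frob_inner G) (at 0)"
proof -
  let ?r = "\<lambda>E. F ((mat 1 + E) ** W) - F W - frob_inner G E"
  have "has_relative_gradient F G W \<longleftrightarrow> ((\<lambda>E. ?r E / norm E) \<longlongrightarrow> 0) (at 0)"
    unfolding has_relative_gradient_def
    by (auto intro: smalloI_tendsto dest: smalloD_tendsto simp: eventually_at_filter)
  also have "\<dots> \<longleftrightarrow> ((\<lambda>E. norm (?r E) / norm E) \<longlongrightarrow> 0) (at 0)"
    using tendsto_rabs_zero_iff[of "\<lambda>E. ?r E / norm E" "at 0"] by simp
  also have "\<dots> \<longleftrightarrow> ((\<lambda>E. F ((mat 1 + E) ** W)) has_derivative frob_inner G) (at 0)"
    by (simp add: has_derivative_at frob_inner_eq_inner[abs_def] bounded_linear_inner_right)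
  finally show ?thesis .
qed

lemma has_relative_gradient_unique:
  assumes "has_relative_gradient F G W" "has_relative_gradient F H W"
  shows "G = H"
proof -
  have "frob_inner G = frob_inner H"
    using assms unfolding has_relative_gradient_iff_has_derivative by (rule has_derivative_unique)
  hence "\<forall>E. G \<bullet> E = H \<bullet> E"
    by (metis frob_inner_eq_inner)
  thus ?thesis by (simp add: vector_eq_rdot)
qed

lemma relative_gradient_eqI:
  "has_relative_gradient F G W \<Longrightarrow> relative_gradient F W = G"
  unfolding relative_gradient_def
  by (rule the_equality) (auto intro: has_relative_gradient_unique)

text \<open>
  A derivative is linear, so it is determined by its values on the matrix units; these are the
  partial derivatives, by the chain rule along the line through \<open>W\<close> in that direction.
\<close>

lemma frechet_derivative_eq_grad:
  fixes F :: "real^'k^'k \<Rightarrow> real"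
  assumes "(F has_derivative D) (at W)"
  shows "D = frob_inner (grad F W)"
proof
  fix H :: "real^'k^'k"
  have lin: "linear D"
    using assms by (rule has_derivative_linear)
  have dir: "partial_deriv F i j W = D (axis i (axis j 1))" for i j
  proof -
    have "((\<lambda>t. W + t *\<^sub>R axis i (axis j 1)) has_derivative (\<lambda>t. t *\<^sub>R axis i (axis j 1))) (at 0)"
      by (auto intro!: derivative_eq_intros)
    from has_derivative_compose[OF this, of F D] assms
    have "((\<lambda>t. F (W + t *\<^sub>R axis i (axis j 1))) has_derivative
        (\<lambda>t. D (t *\<^sub>R axis i (axis j 1)))) (at 0)" by simp
    hence "((\<lambda>t. F (W + t *\<^sub>R axis i (axis j 1))) has_real_derivative
        D (axis i (axis j 1))) (at 0)"
      by (simp add: has_field_derivative_def linear_cmul[OF lin] mult_commute_abs)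
    thus ?thesis unfolding partial_deriv_def by (rule DERIV_imp_deriv)
  qed
  have "(H $ i $ j *\<^sub>R axis i (axis j 1)) $ m $ n =
      (if j = n then if i = m then H $ i $ j else 0 else 0)" for i j m n
    by (simp add: axis_def)
  hence "H = (\<Sum>i\<in>UNIV. \<Sum>j\<in>UNIV. H $ i $ j *\<^sub>R axis i (axis j 1))"
    by (simp only: vec_eq_iff sum_component) simp
  hence "D H = D (\<Sum>i\<in>UNIV. \<Sum>j\<in>UNIV. H $ i $ j *\<^sub>R axis i (axis j 1))"
    by (rule arg_cong)
  also have "\<dots> = (\<Sum>i\<in>UNIV. \<Sum>j\<in>UNIV. H $ i $ j * D (axis i (axis j 1)))"
    by (simp add: linear_sum[OF lin] linear_cmul[OF lin])
  also have "\<dots> = frob_inner (grad F W) H"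
    by (simp add: frob_inner_eq_inner inner_vec_def grad_def dir mult.commute)
  finally show "D H = frob_inner (grad F W) H" .
qed

text \<open>
  Chain rule for \<open>F\<close> after the affine map \<open>E \<mapsto> (I + E) W\<close>; the adjoint of its linear part
  supplies the factor \<open>W\<^sup>T\<close>.
\<close>

lemma has_relative_gradient_grad:
  assumes "F differentiable (at W)"
  shows "has_relative_gradient F (grad F W ** transpose W) W"
proof -
  have F: "(F has_derivative frob_inner (grad F W)) (at W)"
    using assms frechet_derivative_eq_grad unfolding differentiable_def by blast
  hence F0: "(F has_derivative frob_inner (grad F W)) (at ((mat 1 + 0) ** W))"
    by simp
  have "((\<lambda>E. (mat 1 + E) ** W) has_derivative (\<lambda>E. E ** W)) (at 0)"
    unfolding matrix_add_rdistrib matrix_mul_lid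
    by (auto intro!: derivative_eq_intros bounded_linear.has_derivative[OF bounded_linear_matrix_mult_left])
  from has_derivative_compose[OF this F0] show ?thesis
    by (simp only: has_relative_gradient_iff_has_derivative frob_inner_mult_right)
qed

section \<open>The gradient of the log-determinant\<close>

text \<open>
  The unit vector \<open>e\<^sub>b\<close> is the combination of the rows of \<open>W\<close> with coefficients taken from
  row \<open>b\<close> of \<open>B\<close>, because \<open>B W = I\<close>.  So the new row \<open>a\<close>, namely \<open>w\<^sub>a + t e\<^sub>b\<close>, is a combination
  of the rows of \<open>W\<close> in which \<open>w\<^sub>a\<close> has the coefficient \<open>1 + t B\<^sub>b\<^sub>a\<close>, and Cramer's lemma says that
  the determinant is multiplied by just this coefficient.
\<close>

lemma det_add_matrix_unit:
  fixes W B :: "real^'k^'k"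
  assumes "B ** W = mat 1"
  shows "det (W + t *\<^sub>R axis a (axis b 1)) = (1 + t * B $ b $ a) * det W"
proof -
  let ?x = "\<chi> i. (if i = a then 1 else 0) + t * B $ b $ i"
  have unit: "(\<Sum>i\<in>UNIV. B $ b $ i * W $ i $ n) = (if b = n then 1 else 0)" for n
    using assms by (simp add: vec_eq_iff matrix_matrix_mult_def mat_def)
  have "(\<Sum>i\<in>UNIV. ?x $ i * W $ i $ n) =
      (\<Sum>i\<in>UNIV. (if i = a then W $ i $ n else 0) + t * (B $ b $ i * W $ i $ n))" for n
    by (intro sum.cong) (auto simp: algebra_simps)
  hence "(\<Sum>i\<in>UNIV. ?x $ i * W $ i $ n) = W $ a $ n + (if b = n then t else 0)" for n
    by (simp add: sum.distrib unit flip: sum_distrib_left)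
  hence "(\<Sum>i\<in>UNIV. ?x $ i *s row i W) = row a (W + t *\<^sub>R axis a (axis b 1))"
    by (simp add: vec_eq_iff row_def axis_def del: vec_lambda_beta) (simp add: axis_def)
  hence "(\<chi> i. if i = a then \<Sum>i\<in>UNIV. ?x $ i *s row i W else row i W) =
      W + t *\<^sub>R axis a (axis b 1)"
    by (auto simp: vec_eq_iff row_def axis_def)
  with cramer_lemma_transpose[of a ?x W] show ?thesis by simp
qed

lemma has_real_derivative_ln_abs_det:
  fixes W B :: "real^'k^'k"
  assumes BW: "B ** W = mat 1"
  shows "((\<lambda>t. ln \<bar>det (W + t *\<^sub>R axis a (axis b 1))\<bar>) has_real_derivative B $ b $ a) (at 0)"
proof -
  \<comment> \<open>Near \<open>t = 0\<close> the factor \<open>1 + t B\<^sub>b\<^sub>a\<close> is positive, so the logarithm splits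
      into \<open>ln (1 + t B\<^sub>b\<^sub>a)\<close> and the constant \<open>ln |det W|\<close>.\<close>
  have "det B * det W = 1"
    using BW by (metis det_I det_mul)
  hence dW: "det W \<noteq> 0" by auto
  have "((\<lambda>t. 1 + t * B $ b $ a) \<longlongrightarrow> 1) (at 0)"
    by (auto intro!: tendsto_eq_intros)
  hence "\<forall>\<^sub>F t in at 0. 1 + t * B $ b $ a > 0"
    by (rule order_tendstoD) simp
  hence "\<forall>\<^sub>F t in nhds 0. 1 + t * B $ b $ a > 0"
    by (simp add: eventually_nhds_conv_at)
  hence ev: "\<forall>\<^sub>F t in nhds 0. ln \<bar>det (W + t *\<^sub>R axis a (axis b 1))\<bar> =
      ln (1 + t * B $ b $ a) + ln \<bar>det W\<bar>"
    by eventually_elim (use dW in \<open>simp add: det_add_matrix_unit[OF BW] abs_mult ln_mult\<close>)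
  have "((\<lambda>t. ln (1 + t * B $ b $ a) + ln \<bar>det W\<bar>) has_real_derivative B $ b $ a) (at 0)"
    by (auto intro!: derivative_eq_intros)
  thus ?thesis by (subst DERIV_cong_ev[OF refl ev refl])
qed

section \<open>The gradient of the ICA log-likelihood\<close>

lemma partial_deriv_ln_row:
  fixes W :: "real^'k^'k"
  assumes pos: "\<And>x. q x > 0" and diff: "\<And>x. q differentiable (at x)"
  shows "partial_deriv (\<lambda>V. ln (q (row j V \<bullet> x))) a b W =
    (if j = a then score q ((W *v x) $ j) * x $ b else 0)"
proof (cases "j = a")
  case False
  hence "row j (W + t *\<^sub>R axis a (axis b 1)) = row j W" for t
    by (simp add: vec_eq_iff row_def axis_def)
  thus ?thesis using False by (simp add: partial_deriv_def)
next
  case True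
  let ?c = "row a W \<bullet> x"
  have row: "row a (W + t *\<^sub>R axis a (axis b 1)) \<bullet> x = ?c + t * x $ b" for t
  proof -
    have "row a (W + t *\<^sub>R axis a (axis b 1)) = row a W + t *\<^sub>R axis b 1"
      by (simp add: vec_eq_iff row_def axis_def)
    thus ?thesis by (simp add: inner_add_left inner_axis')
  qed
  obtain d where "(q has_real_derivative d) (at ?c)"
    using diff[of ?c] real_differentiable_def by blast
  hence "((\<lambda>t. ln (q t)) has_real_derivative (1 / q ?c * d)) (at ?c)"
    by (intro DERIV_chain2[where f = ln] DERIV_ln_divide pos)
  hence ln: "((\<lambda>t. ln (q t)) has_real_derivative score q ?c) (at ?c)"
    unfolding score_def by (metis DERIV_imp_deriv)
  have "((\<lambda>t. ?c + t * x $ b) has_real_derivative x $ b) (at 0)"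
    by (auto intro!: derivative_eq_intros)
  from DERIV_chain2[of "\<lambda>t. ln (q t)", OF _ this] ln
  have "((\<lambda>t. ln (q (?c + t * x $ b))) has_real_derivative score q ?c * x $ b) (at 0)"
    by simp
  hence "deriv (\<lambda>t. ln (q (?c + t * x $ b))) 0 = score q ?c * x $ b"
    by (rule DERIV_imp_deriv)
  thus ?thesis
    using True by (simp add: partial_deriv_def row) (simp add: matrix_vector_mul_component row_def)
qed

lemma outer_prod_matrix_vector_mult:
  "outer_prod u (B *v v) = outer_prod u v ** transpose B"
  by (simp add: vec_eq_iff outer_prod_def matrix_matrix_mult_def matrix_vector_mult_def
      transpose_def sum_distrib_left algebra_simps)

text \<open>
  The integrability assumption concerns \<open>\<eta>(C) C\<^sup>T\<close>, while differentiation produces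
  \<open>\<eta>\<^sub>a(C\<^sub>a) X\<^sub>b\<close>.  Writing \<open>X = B C\<close> turns the latter into a bounded linear image of \<open>\<eta>(C) C\<^sup>T\<close>, which may be taken out of the integral.
\<close>

lemma integral_score_outer_prod:
  fixes W B :: "real^'k^'k" and X :: "'a \<Rightarrow> real^'k"
  assumes BW: "B ** W = mat 1"
    and int: "integrable M (\<lambda>\<omega>. outer_prod (score_vec p (W *v X \<omega>)) (W *v X \<omega>))"
  shows "(\<integral>\<omega>. score (p a) ((W *v X \<omega>) $ a) * X \<omega> $ b \<partial>M) =
    (score_moment M X p W ** transpose B) $ a $ b"
proof -
  have X: "X \<omega> = B *v (W *v X \<omega>)" for \<omega>
    by (simp add: matrix_vector_mul_assoc BW)
  have lin: "bounded_linear (\<lambda>S :: real^'k^'k. (S ** transpose B) $ a $ b)"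
    by (intro bounded_linear_vec_nth[THEN bounded_linear_compose] bounded_linear_matrix_mult_left)
  have "score (p a) ((W *v X \<omega>) $ a) * X \<omega> $ b =
      (outer_prod (score_vec p (W *v X \<omega>)) (W *v X \<omega>) ** transpose B) $ a $ b" for \<omega>
    unfolding outer_prod_matrix_vector_mult[symmetric] X[symmetric]
    by (simp add: outer_prod_def score_vec_def)
  thus ?thesis
    using integral_bounded_linear[OF lin int] by (simp add: score_moment_def)
qed

lemma grad_log_likelihood:
  fixes W B :: "real^'k^'k" and X :: "'a \<Rightarrow> real^'k"
  assumes BW: "B ** W = mat 1"
    and pos: "\<And>j x. p j x > 0" and diff: "\<And>j x. p j differentiable (at x)"
    and reg: "ica_regular_at M X p W"
  shows "grad (log_likelihood M X p) W = (mat 1 + score_moment M X p W) ** transpose B"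
proof -
  have "grad (log_likelihood M X p) W $ a $ b =
      ((mat 1 + score_moment M X p W) ** transpose B) $ a $ b" for a b
  proof -
    have int: "integrable M (\<lambda>\<omega>. outer_prod (score_vec p (W *v X \<omega>)) (W *v X \<omega>))"
      and deriv: "((\<lambda>t. expected_log_density M X p j (W + t *\<^sub>R axis a (axis b 1)))
        has_real_derivative
          (\<integral>\<omega>. partial_deriv (\<lambda>V. ln (p j (row j V \<bullet> X \<omega>))) a b W \<partial>M)) (at 0)" for j
      using reg by (auto simp: ica_regular_at_def)
    \<comment> \<open>For \<open>j \<noteq> a\<close> the integrand vanishes identically, so the sum over \<open>j\<close> below
        has a single term.\<close>
    have "(\<integral>\<omega>. partial_deriv (\<lambda>V. ln (p j (row j V \<bullet> X \<omega>))) a b W \<partial>M) =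
        (if j = a then (score_moment M X p W ** transpose B) $ a $ b else 0)" for j
      by (simp add: partial_deriv_ln_row[OF pos diff] integral_score_outer_prod[OF BW int])
    from deriv[unfolded this] have "((\<lambda>t. expected_log_density M X p j (W + t *\<^sub>R axis a (axis b 1)))
        has_real_derivative
          (if j = a then (score_moment M X p W ** transpose B) $ a $ b else 0)) (at 0)" for j .
    hence "((\<lambda>t. \<Sum>j\<in>UNIV. expected_log_density M X p j (W + t *\<^sub>R axis a (axis b 1)))
        has_real_derivative (\<Sum>j\<in>UNIV.
          if j = a then (score_moment M X p W ** transpose B) $ a $ b else 0)) (at 0)"
      by (rule DERIV_sum)
    from DERIV_add[OF has_real_derivative_ln_abs_det[OF BW] this]
    have "((\<lambda>t. log_likelihood M X p (W + t *\<^sub>R axis a (axis b 1))) has_real_derivative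
        B $ b $ a + (score_moment M X p W ** transpose B) $ a $ b) (at 0)"
      by (simp add: log_likelihood_def)
    hence "partial_deriv (log_likelihood M X p) a b W =
        B $ b $ a + (score_moment M X p W ** transpose B) $ a $ b"
      unfolding partial_deriv_def by (rule DERIV_imp_deriv)
    thus ?thesis
      by (simp add: grad_def matrix_add_rdistrib) (simp add: transpose_def)
  qed
  thus ?thesis by (simp add: vec_eq_iff)
qed

section \<open>Relative gradient ascent\<close>

theorem proposition7p13:
  fixes M :: "'a measure"
    and A :: "real^'k^'k"
    and Z X :: "'a \<Rightarrow> real^'k"
    and p :: "'k \<Rightarrow> real \<Rightarrow> real"
  shows
    "(\<forall>(F :: real^'k^'k \<Rightarrow> real) W. F differentiable_on GL \<and> W \<in> GL \<longrightarrow>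
        (\<exists>!G. has_relative_gradient F G W) \<and>
        relative_gradient F W = grad F W ** transpose W \<and>
        (\<forall>\<alpha>>0. relative_ascent_step \<alpha> F W = W + \<alpha> *\<^sub>R (grad F W ** transpose W ** W)))
     \<and>
     (ica_model M A Z X p \<longrightarrow>
       (\<forall>W \<in> GL. ica_regular_at M X p W \<longrightarrow>
          (\<exists>!G. has_relative_gradient (log_likelihood M X p) G W) \<and>
          relative_gradient (log_likelihood M X p) W = mat 1 + score_moment M X p W \<and>
          (\<forall>\<alpha>>0. W + \<alpha> *\<^sub>R (grad (log_likelihood M X p) W ** transpose W ** W)
                 = (mat 1 + \<alpha> *\<^sub>R (mat 1 + score_moment M X p W)) ** W)))"
proof (intro conjI allI impI ballI)
  fix F :: "real^'k^'k \<Rightarrow> real" and W :: "real^'k^'k"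
  assume FW: "F differentiable_on GL \<and> W \<in> GL"
  hence "F differentiable (at W)"
    by (simp add: differentiable_on_eq_differentiable_at[OF open_GL])
  hence G: "has_relative_gradient F (grad F W ** transpose W) W"
    by (rule has_relative_gradient_grad)
  thus "\<exists>!G. has_relative_gradient F G W"
    using has_relative_gradient_unique by blast
  show rel: "relative_gradient F W = grad F W ** transpose W"
    using G by (rule relative_gradient_eqI)
  fix \<alpha> :: real
  show "relative_ascent_step \<alpha> F W = W + \<alpha> *\<^sub>R (grad F W ** transpose W ** W)"
    by (simp only: relative_ascent_step_def rel matrix_add_rdistrib matrix_mul_lid
        flip: scalar_matrix_assoc)
next
  fix W :: "real^'k^'k"
  let ?L = "log_likelihood M X p" and ?S = "score_moment M X p W"
  assume model: "ica_model M A Z X p" and W: "W \<in> GL" and reg: "ica_regular_at M X p W"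
  obtain B where BW: "B ** W = mat 1" and WB: "W ** B = mat 1"
    using W by (auto simp: GL_def invertible_def)
  have "grad ?L W = (mat 1 + ?S) ** transpose B"
    using BW ica_model.model_pos[OF model] ica_model.model_differentiable[OF model] reg
    by (rule grad_log_likelihood)
  hence grad: "grad ?L W ** transpose W = mat 1 + ?S"
    by (simp add: WB flip: matrix_mul_assoc matrix_transpose_mul)
  have "?L differentiable (at W)"
    using reg by (simp add: ica_regular_at_def)
  hence G: "has_relative_gradient ?L (mat 1 + ?S) W"
    using has_relative_gradient_grad grad by metis
  thus "\<exists>!G. has_relative_gradient ?L G W"
    using has_relative_gradient_unique by blast
  show "relative_gradient ?L W = mat 1 + ?S"
    using G by (rule relative_gradient_eqI)
  fix \<alpha> :: real
  show "W + \<alpha> *\<^sub>R (grad ?L W ** transpose W ** W) = (mat 1 + \<alpha> *\<^sub>R (mat 1 + ?S)) ** W"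
    by (simp only: grad matrix_add_rdistrib matrix_mul_lid flip: scalar_matrix_assoc)
qed

end
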